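(* Let $d\ge1$, $\beta>0$, let $f:(0,\infty)\to\mathbb R$ be convex and twice differentiable, let $G:(0,\infty)\to(0,\infty)$ be differentiable, and let $\mathfrak m:(0,\infty)\times(0,\infty)\to(0,\infty)$. Suppose that for all $s>0$, $\vartheta>0$ and all vectors $p,q\in\mathbb R^d$, $$\mathfrak m(s,\vartheta)\bigl(f''(s)\,p-2\beta\,q\bigr)=\frac12G(\vartheta)^2\,p+s\,G(\vartheta)G'(\vartheta)\,q .$$ Then there exist constants $c>0$, $k>0$ and $a,b\in\mathbb R$ such that for all $s,\vartheta>0$ $$f(s)=c\,s(\log s-1)+a\,s+b,\qquad G(\vartheta)=k\exp\left(-\frac{\beta}{c}\vartheta\right),\qquad \mathfrak m(s,\vartheta)=\frac{k^2}{2c}\,s\exp\left(-\frac{2\beta}{c}\vartheta\right).$$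
   Context: Interpretation (not needed for the statement): the identity expresses that the flux $\frac12\nabla(G(\vartheta)^2\varrho)$, with $\vartheta=W\ast\varrho$, of the equation $\partial_t\varrho=\frac12\Delta(G(W\ast\varrho)^2\varrho)$ coincides with the flux $\mathfrak m(\varrho,\vartheta)\nabla\frac{\delta\mathcal E_\beta}{\delta\varrho}$ of a generalized gradient flow of $\mathcal E_\beta(\varrho)=\int f(\varrho)\,\mathrm dx-\beta\int\varrho(W\ast\varrho)\,\mathrm dx$, with $\nabla\varrho$ (written $p$) and $\nabla\vartheta$ (written $q$) regarded as independently variable. *)

theory Defs
  imports "HOL-Analysis.Analysis"
begin

end

(* Choosing (p, q) = (v, 0) and (0, v) with v nonzero gives m f'' = G^2 / 2 and
   2 beta m = - s G G'.  Eliminating m separates the variables: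
   s f''(s) = - beta G(theta) / G'(theta), so both sides equal a constant c > 0,
   and the resulting equations f'' = c / s and G' = - (beta / c) G are integrated
   directly. *)
theory Submission
  imports Defs
begin

text \<open>Differentiability on the open half-line is differentiability at each of its points. The
  result is restricted to \<open>{0<..}\<close> again to fit the integration lemma below.\<close>

lemma has_deriv_within_if_differentiable_on_Ioi:
  fixes f :: "real \<Rightarrow> real"
  assumes "f differentiable_on {0<..}" and "x > 0"
  shows "(f has_field_derivative deriv f x) (at x within {0<..})"
proof -
  have "f differentiable (at x)"
    using assms differentiable_on_eq_differentiable_at[OF open_greaterThan] by blast
  then show ?thesis
    using DERIV_deriv_iff_real_differentiable DERIV_subset by blast
qed

text \<open>The difference has zero derivative on the convex set \<open>{0<..}\<close>, hence is
  constant there. Each integration below (for \<open>deriv f\<close>, \<open>f\<close> and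
  \<open>G\<close>) is one use of this lemma.\<close>

lemma eq_up_to_constant_on_Ioi:
  fixes f g :: "real \<Rightarrow> real"
  assumes "\<And>x. x > 0 \<Longrightarrow> (f has_field_derivative D x) (at x within {0<..})"
    and "\<And>x. x > 0 \<Longrightarrow> (g has_field_derivative D x) (at x within {0<..})"
  obtains C where "\<And>x. x > 0 \<Longrightarrow> f x = g x + C"
proof -
  have "((\<lambda>x. f x - g x) has_field_derivative 0) (at x within {0<..})" if "x \<in> {0<..}" for x
    using DERIV_diff[OF assms(1) assms(2), of x] that by simp
  then obtain C where "\<forall>x\<in>{0<..}. f x - g x = C"
    using has_field_derivative_zero_constant[of "{0<..}" "\<lambda>x. f x - g x"] by auto
  then show thesis
    by (intro that[of C]) (auto simp: algebra_simps)
qed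

theorem mainTheorem2:
  fixes \<beta> :: real
    and f G :: "real \<Rightarrow> real"
    and \<mm> :: "real \<Rightarrow> real \<Rightarrow> real"
  assumes "\<beta> > 0"
    and "convex_on {0<..} f"
    and "f differentiable_on {0<..}"
    and "deriv f differentiable_on {0<..}"
    and "\<And>\<theta>. \<theta> > 0 \<Longrightarrow> G \<theta> > 0"
    and "G differentiable_on {0<..}"
    and "\<And>s \<theta>. s > 0 \<Longrightarrow> \<theta> > 0 \<Longrightarrow> \<mm> s \<theta> > 0"
    and "\<And>s \<theta> (p :: real ^ 'd) (q :: real ^ 'd). s > 0 \<Longrightarrow> \<theta> > 0 \<Longrightarrow>
           \<mm> s \<theta> *\<^sub>R (deriv (deriv f) s *\<^sub>R p - (2 * \<beta>) *\<^sub>R q)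
             = (1 / 2 * (G \<theta>)\<^sup>2) *\<^sub>R p + (s * G \<theta> * deriv G \<theta>) *\<^sub>R q"
  shows "\<exists>c k a b :: real. c > 0 \<and> k > 0 \<and>
           (\<forall>s>0. \<forall>\<theta>>0.
              f s = c * s * (ln s - 1) + a * s + b \<and>
              G \<theta> = k * exp (- (\<beta> / c) * \<theta>) \<and>
              \<mm> s \<theta> = k\<^sup>2 / (2 * c) * s * exp (- (2 * \<beta> / c) * \<theta>))"
proof -
  \<comment> \<open>Index types are nonempty, so a unit vector exists along some coordinate; which
    one is irrelevant. Since \<open>v\<close> is nonzero, it can be cancelled from an equation
    between two of its multiples.\<close>
  define v :: "real ^ 'd" where "v = axis undefined 1"
  have v: "v \<noteq> 0"
    by (simp add: v_def)
  have p_part: "\<mm> s \<theta> * deriv (deriv f) s = (G \<theta>)\<^sup>2 / 2" if "s > 0" "\<theta> > 0" for s \<theta>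
  proof -
    have "(\<mm> s \<theta> * deriv (deriv f) s) *\<^sub>R v = ((G \<theta>)\<^sup>2 / 2) *\<^sub>R v"
      using assms(8)[OF that, of v 0] by simp
    with v show ?thesis
      by (metis scaleR_cancel_right)
  qed
  have q_part: "2 * \<beta> * \<mm> s \<theta> = - (s * G \<theta> * deriv G \<theta>)" if "s > 0" "\<theta> > 0" for s \<theta>
  proof -
    have "(- (2 * \<beta> * \<mm> s \<theta>)) *\<^sub>R v = (s * G \<theta> * deriv G \<theta>) *\<^sub>R v"
      using assms(8)[OF that, of 0 v] by (simp add: mult_ac)
    then have "- (2 * \<beta> * \<mm> s \<theta>) = s * G \<theta> * deriv G \<theta>"
      using v by (metis scaleR_cancel_right)
    then show ?thesis by simp
  qed
  \<comment> \<open>This is the separation constant: the value of s f''(s) at s = 1.\<close>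
  define c where "c = deriv (deriv f) 1"
  have f2_pos: "deriv (deriv f) s > 0" if "s > 0" for s
  proof -
    have "\<mm> s 1 * deriv (deriv f) s > 0"
      unfolding p_part[OF that zero_less_one] using assms(5)[of 1] by simp
    then show ?thesis
      using assms(7)[OF that, of 1] by (simp add: zero_less_mult_iff)
  qed
  have c: "c > 0"
    by (simp add: c_def f2_pos)
  \<comment> \<open>Multiply \<open>q_part\<close> by f''(s), replace \<mm> f'' by means of
    \<open>p_part\<close>, and cancel one factor \<open>G \<theta>\<close>. The product form avoids
    dividing by G', not yet known to be nonzero.\<close>
  have separated: "s * deriv (deriv f) s * deriv G \<theta> = - (\<beta> * G \<theta>)"
    if "s > 0" "\<theta> > 0" for s \<theta>
  proof -
    have "G \<theta> * (s * deriv (deriv f) s * deriv G \<theta>)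
        = - (2 * \<beta> * \<mm> s \<theta>) * deriv (deriv f) s"
      unfolding q_part[OF that] by simp
    also have "\<dots> = - (2 * \<beta> * (\<mm> s \<theta> * deriv (deriv f) s))"
      by simp
    also have "\<dots> = G \<theta> * (- (\<beta> * G \<theta>))"
      unfolding p_part[OF that] by (simp add: power2_eq_square)
    finally show ?thesis
      using assms(5)[OF that(2)] by (metis less_irrefl mult_left_cancel)
  qed
  have G': "deriv G \<theta> = - (\<beta> / c) * G \<theta>" if "\<theta> > 0" for \<theta>
    using separated[of 1 \<theta>] that c by (simp add: c_def field_simps)
  have f2: "deriv (deriv f) s = c / s" if "s > 0" for s
  proof -
    \<comment> \<open>With \<theta> = 1 fixed, the right-hand side of \<open>separated\<close> does
      not depend on s. Comparing s with 1 and cancelling G'(1) makes s f''(s) equal to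
      \<open>c\<close>.\<close>
    have "deriv G 1 \<noteq> 0"
      using G'[of 1] c assms(1) assms(5)[of 1] by simp
    moreover have "s * deriv (deriv f) s * deriv G 1 = c * deriv G 1"
      using separated[OF that, of 1] separated[of 1 1] by (simp add: c_def)
    ultimately show ?thesis
      using that by (simp add: field_simps)
  qed
  obtain a where a: "\<And>s. s > 0 \<Longrightarrow> deriv f s = c * ln s + a"
  proof (rule eq_up_to_constant_on_Ioi)
    show "(deriv f has_field_derivative c / s) (at s within {0<..})" if "s > 0" for s
      using has_deriv_within_if_differentiable_on_Ioi[OF assms(4) that] f2[OF that] by simp
    show "((\<lambda>s. c * ln s) has_field_derivative c / s) (at s within {0<..})" if "s > 0" for s
      using that by (auto intro!: derivative_eq_intros)
  qed blast
  obtain b where b: "\<And>s. s > 0 \<Longrightarrow> f s = (c * s * (ln s - 1) + a * s) + b"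
  proof (rule eq_up_to_constant_on_Ioi)
    show "(f has_field_derivative c * ln s + a) (at s within {0<..})" if "s > 0" for s
      using has_deriv_within_if_differentiable_on_Ioi[OF assms(3) that] a[OF that] by simp
    show "((\<lambda>s. c * s * (ln s - 1) + a * s) has_field_derivative c * ln s + a)
        (at s within {0<..})" if "s > 0" for s
      using that by (auto intro!: derivative_eq_intros simp: algebra_simps)
  qed blast
  \<comment> \<open>The exponential is the integrating factor of G' = -(\<beta> / c) G. The summand
    0 lets the integration lemma apply with the zero function as \<open>g\<close>.\<close>
  obtain k where k: "\<And>\<theta>. \<theta> > 0 \<Longrightarrow> G \<theta> * exp (\<beta> / c * \<theta>) = 0 + k"
  proof (rule eq_up_to_constant_on_Ioi)
    show "((\<lambda>\<theta>. G \<theta> * exp (\<beta> / c * \<theta>)) has_field_derivative 0) (at \<theta> within {0<..})"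
      if "\<theta> > 0" for \<theta>
      using has_deriv_within_if_differentiable_on_Ioi[OF assms(6) that] G'[OF that] c
      by (auto intro!: derivative_eq_intros)
    show "((\<lambda>_. 0) has_field_derivative 0) (at \<theta> within {0<..})" for \<theta> :: real
      by simp
  qed blast
  have G: "G \<theta> = k * exp (- (\<beta> / c) * \<theta>)" if "\<theta> > 0" for \<theta>
    using k[OF that] by (simp add: exp_minus field_simps)
  have k_pos: "k > 0"
  proof -
    have "0 < G 1 * exp (\<beta> / c * 1)"
      using assms(5)[of 1] by simp
    then show ?thesis
      unfolding k[OF zero_less_one] by simp
  qed
  have m: "\<mm> s \<theta> = k\<^sup>2 / (2 * c) * s * exp (- (2 * \<beta> / c) * \<theta>)"
    if "s > 0" "\<theta> > 0" for s \<theta>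
  proof -
    \<comment> \<open>Inserting f'' = c / s into \<open>p_part\<close> determines \<mm>; squaring
      \<open>G\<close> then doubles the exponent.\<close>
    have "\<mm> s \<theta> = (G \<theta>)\<^sup>2 / (2 * c) * s"
      using p_part[OF that] unfolding f2[OF that(1)] using c that by (simp add: field_simps)
    also have "(G \<theta>)\<^sup>2 = k\<^sup>2 * exp (- (2 * \<beta> / c) * \<theta>)"
      unfolding G[OF that(2)] power_mult_distrib by (simp flip: exp_double)
    finally show ?thesis by simp
  qed
  show ?thesis
  proof (intro exI conjI allI impI)
    show "c > 0" "k > 0"
      by (fact c, fact k_pos)
  qed (simp_all only: b G m)
qed

end
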